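(* Let $n,m\ge1$ and let $\alpha_1,\dots,\alpha_n,\beta_1,\dots,\beta_m$ be quasimultiplicative weight functions. Let $\Theta\in\mathbf M_{n,m}$, let $f:(0,\infty)\to(0,\infty)$ be continuous and strictly decreasing, $g(T)=1/f^{-1}(1/T)$, and suppose $\Theta^\top$ is $(f,\underline\beta,\underline\alpha)$-approximable. For $\varepsilon>0$ let $\tilde g_\varepsilon(T)=\varepsilon\, g(T/\varepsilon)$. Then, if $\varepsilon>0$ is small enough, the set of $\pmb\eta\in\mathbb R^n$ such that $(\Theta,\pmb\eta)$ is $(\tilde g_\varepsilon,\underline\alpha,\underline\beta)$-Dirichlet has Lebesgue measure zero.
   Context: A weight function is a function $h:[0,\infty)\to[0,\infty)$ such that on $[1,\infty)$ it is positive, increasing, continuous, with $h(1)=1$ and $h(T)\to\infty$, extended by $h(T)=1/h(1/T)$ for $0<T\le1$ and $h(0)=0$. An increasing $h$ is quasimultiplicative if there are $M>1$, $1<c_1\le c_2$ with $c_1h(M^k)\le h(M^{k+1})\le c_2h(M^k)$ for all integers $k$ with $|k|$ large. $\|x\|$ is the distance of $x\in\mathbb R$ to the nearest integer; $|\mathbf y|_{\underline\alpha}=\max_i\alpha_i^{-1}(|y_i|)$ for $\mathbf y\in\mathbb R^n$; $\|\mathbf x\|_{\underline\beta}=\min_{\mathbf p\in\mathbb Z^m}\max_j\beta_j^{-1}(|x_j-p_j|)$ for $\mathbf x\in\mathbb R^m$. $\Theta^\top$ is $(f,\underline\beta,\underline\alpha)$-approximable if $\|\Theta^\top\mathbf y\|_{\underline\beta}\le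 f(|\mathbf y|_{\underline\alpha})$ for infinitely many $\mathbf y\in\mathbb Z^n\setminus\{\mathbf 0\}$. $(\Theta,\pmb\eta)$ is $(g,\underline\alpha,\underline\beta)$-Dirichlet if for all sufficiently large $T$ there is $\mathbf q\in\mathbb Z^m\setminus\{\mathbf 0\}$ with $\|\Theta_i\mathbf q-\eta_i\|\le\alpha_i(g(T))$ for all $i$ ($\Theta_i$ the $i$-th row) and $|q_j|\le\beta_j(T)$ for all $j$. *)

theory Defs
  imports "HOL-Analysis.Analysis"
begin

text \<open>Only the values on $[0,\infty)$ matter. The inverse functions $\alpha_i^{-1}$, $\beta_j^{-1}$
  are used below, so ``increasing'' is read as strictly increasing; then \<open>h\<close> is a bijection of
  $[0,\infty)$ onto itself.\<close>

definition weight_function :: "(real \<Rightarrow> real) \<Rightarrow> bool" where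
  "weight_function h \<longleftrightarrow>
     (\<forall>T\<ge>1. h T > 0) \<and> strict_mono_on {1..} h \<and> continuous_on {1..} h \<and>
     h 1 = 1 \<and> filterlim h at_top at_top \<and>
     (\<forall>T. 0 < T \<and> T \<le> 1 \<longrightarrow> h T = 1 / h (1 / T)) \<and> h 0 = 0"

definition quasimultiplicative :: "(real \<Rightarrow> real) \<Rightarrow> bool" where
  "quasimultiplicative h \<longleftrightarrow>
     (\<exists>M c\<^sub>1 c\<^sub>2 :: real. M > 1 \<and> 1 < c\<^sub>1 \<and> c\<^sub>1 \<le> c\<^sub>2 \<and>
        (\<exists>K::int. \<forall>k::int. \<bar>k\<bar> \<ge> K \<longrightarrow>
           c\<^sub>1 * h (M powi k) \<le> h (M powi (k + 1)) \<and>
           h (M powi (k + 1)) \<le> c\<^sub>2 * h (M powi k)))"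

definition weight_inv :: "(real \<Rightarrow> real) \<Rightarrow> real \<Rightarrow> real" where
  "weight_inv h = the_inv_into {0..} h"

definition dist_nearest_int :: "real \<Rightarrow> real" where
  "dist_nearest_int x = \<bar>x - of_int (round x)\<bar>"

definition real_vec :: "int ^ 'k \<Rightarrow> real ^ 'k" where
  "real_vec v = (\<chi> i. of_int (v $ i))"

definition weighted_size :: "('k::finite \<Rightarrow> real \<Rightarrow> real) \<Rightarrow> real ^ 'k \<Rightarrow> real" where
  "weighted_size \<alpha> y = (MAX i. weight_inv (\<alpha> i) \<bar>y $ i\<bar>)"

text \<open>The infimum is a minimum when the \<open>\<beta> j\<close> are weight functions, since then
  only finitely many \<open>p\<close> stay below any given bound.\<close>

definition weighted_dist_int :: "('k::finite \<Rightarrow> real \<Rightarrow> real) \<Rightarrow> real ^ 'k \<Rightarrow> real" where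
  "weighted_dist_int \<beta> x = (INF p :: int ^ 'k. weighted_size \<beta> (x - real_vec p))"

definition approximable ::
    "(real \<Rightarrow> real) \<Rightarrow> ('m::finite \<Rightarrow> real \<Rightarrow> real) \<Rightarrow> ('n::finite \<Rightarrow> real \<Rightarrow> real) \<Rightarrow>
     real ^ 'n ^ 'm \<Rightarrow> bool" where
  "approximable f \<beta> \<alpha> A \<longleftrightarrow>
     infinite {y :: int ^ 'n. y \<noteq> 0 \<and>
       weighted_dist_int \<beta> (A *v real_vec y) \<le> f (weighted_size \<alpha> (real_vec y))}"

definition dirichlet ::
    "(real \<Rightarrow> real) \<Rightarrow> ('n::finite \<Rightarrow> real \<Rightarrow> real) \<Rightarrow> ('m::finite \<Rightarrow> real \<Rightarrow> real) \<Rightarrow>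
     real ^ 'm ^ 'n \<Rightarrow> real ^ 'n \<Rightarrow> bool" where
  "dirichlet g \<alpha> \<beta> \<Theta> \<eta> \<longleftrightarrow>
     (\<forall>\<^sub>F T in at_top. \<exists>q :: int ^ 'm. q \<noteq> 0 \<and>
        (\<forall>i. dist_nearest_int ((\<Theta> *v real_vec q) $ i - \<eta> $ i) \<le> \<alpha> i (g T)) \<and>
        (\<forall>j. real_of_int \<bar>q $ j\<bar> \<le> \<beta> j T))"

text \<open>$g(T) = 1/f^{-1}(1/T)$ for \<open>f\<close> strictly decreasing on $(0,\infty)$. If $f$ tends to \<open>0\<close> at
  infinity, $1/T$ lies in the range of \<open>f\<close> for all large \<open>T\<close>, and the \<open>else\<close> branch concerns
  bounded \<open>T\<close> only, which the Dirichlet property ignores. If instead $\inf f > 0$, then for large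
  \<open>T\<close> the value \<open>0\<close> is the convention $f^{-1}(s) = \infty$ for $s \le \inf f$.\<close>

definition dual_rate :: "(real \<Rightarrow> real) \<Rightarrow> real \<Rightarrow> real" where
  "dual_rate f T =
     (if 1 / T \<in> f ` {0<..} then 1 / the_inv_into {0<..} f (1 / T) else 0)"

end

theory Submission
  imports Defs
begin

text \<open>Let \<open>y\<close> be one of the infinitely many good approximations for \<open>\<Theta>\<^sup>T\<close>, of size \<open>Y\<close>, and let \<open>\<eta>\<close>
  have the Dirichlet property. Applying the latter at \<open>T = \<epsilon> / f Y\<close> gives \<open>q\<close>, and
  \<open>y \<bullet> \<eta> = y \<bullet> (\<eta> - \<Theta> q) + \<Theta>\<^sup>T y \<bullet> q\<close> lies, modulo \<open>1\<close>, within
  \<open>\<Sum>i. \<alpha>\<^sub>i(Y) / \<alpha>\<^sub>i(Y / \<epsilon>) + \<Sum>j. \<beta>\<^sub>j(T) / \<beta>\<^sub>j(T / \<epsilon>)\<close> of \<open>0\<close>. Quasimultiplicativity makes this at most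
  \<open>1/6\<close> for small \<open>\<epsilon>\<close> and large \<open>Y\<close>. The \<open>\<eta>\<close> for which \<open>y \<bullet> \<eta>\<close> is that close to an integer for
  infinitely many prescribed \<open>y\<close> at once form a null set, by orthogonality of the characters.
  If \<open>f\<close> is bounded away from \<open>0\<close>, the rate eventually vanishes and only countably many \<open>\<eta>\<close> qualify.\<close>

section \<open>Weight functions\<close>

text \<open>The definition states the reciprocal law for arguments at most 1; applying it at
  \<open>1 / t\<close> covers the rest. The law later rewrites \<open>h (\<epsilon> / t)\<close> as
  \<open>1 / h (t / \<epsilon>)\<close>.\<close>

lemma weight_function_inverse:
  assumes h: "weight_function h" and "t > 0"
  shows "h (1 / t) = 1 / h t"
proof (cases "t \<ge> 1")
  case True
  then show ?thesis
    using h unfolding weight_function_def by simp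
next
  case False
  then have "h t = 1 / h (1 / t)"
    using h \<open>t > 0\<close> unfolding weight_function_def by simp
  then show ?thesis by simp
qed

lemma weight_function_pos:
  assumes h: "weight_function h" and "t > 0"
  shows "h t > 0"
proof (cases "t \<ge> 1")
  case True
  then show ?thesis using h unfolding weight_function_def by blast
next
  case False
  then have "h (1 / t) > 0" using h \<open>t > 0\<close> unfolding weight_function_def by simp
  then show ?thesis using weight_function_inverse[OF assms] by simp
qed

text \<open>Inversion reverses the order both of arguments and of values, so monotonicity on
  [1, \<infinity>) carries over to (0, 1]. The point 1 links the two ranges, and positivity settles
  the comparison with \<open>h 0 = 0\<close>.\<close>

lemma weight_function_strict_mono:
  assumes h: "weight_function h"
  shows "strict_mono_on {0..} h"
proof (rule strict_mono_onI)
  fix r s :: real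
  assume "r \<in> {0..}" "s \<in> {0..}" "r < s"
  then have "0 \<le> r" "0 < s" by auto
  have ge1: "h a < h b" if "1 \<le> a" "a < b" for a b
    using h that strict_mono_onD[of "{1..}" h a b] unfolding weight_function_def by simp
  have h1: "h 1 = 1" and h0: "h 0 = 0" using h unfolding weight_function_def by blast+
  have le1: "h a < h b" if "0 < a" "a < b" "b \<le> 1" for a b
  proof -
    have "h (1 / b) < h (1 / a)"
      using that by (intro ge1) (auto simp: divide_simps)
    then show ?thesis
      using that weight_function_inverse[OF h, of a] weight_function_inverse[OF h, of b]
        weight_function_pos[OF h, of a] weight_function_pos[OF h, of b]
      by (simp add: divide_simps)
  qed
  consider "r = 0" | "0 < r" "s \<le> 1" | "0 < r" "r \<ge> 1" | "0 < r" "r < 1" "s > 1"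
    using \<open>0 \<le> r\<close> by linarith
  then show "h r < h s"
  proof cases
    case 1
    then show ?thesis using h0 weight_function_pos[OF h \<open>0 < s\<close>] by simp
  next
    case 2
    then show ?thesis using le1 \<open>r < s\<close> by blast
  next
    case 3
    then show ?thesis using ge1 \<open>r < s\<close> by blast
  next
    case 4
    then show ?thesis using le1[of r 1] ge1[of 1 s] by simp
  qed
qed

lemma weight_function_mono:
  assumes "weight_function h" "0 \<le> s" "s \<le> t"
  shows "h s \<le> h t"
  using strict_mono_onD[OF weight_function_strict_mono[OF assms(1)], of s t] assms
  by (cases "s = t") auto

text \<open>Values at least 1 come from the intermediate value theorem, since \<open>h 1 = 1\<close>
  and \<open>h\<close> is unbounded; values in (0, 1) are reciprocals of these.\<close>

lemma weight_function_surj: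
  assumes h: "weight_function h" and "x \<ge> 0"
  shows "\<exists>t\<ge>0. h t = x"
proof -
  have ge1: "\<exists>t\<ge>1. h t = y" if "y \<ge> 1" for y
  proof -
    have "\<forall>\<^sub>F t in at_top. y \<le> h t \<and> 1 \<le> t"
      using h unfolding weight_function_def
      by (intro eventually_conj eventually_ge_at_top) (simp add: filterlim_at_top)
    then obtain b where b: "y \<le> h b" "1 \<le> b"
      using eventually_happens'[OF trivial_limit_at_top_linorder] by blast
    have "continuous_on {1..} h" and "h 1 = 1"
      using h unfolding weight_function_def by simp_all
    then have "continuous_on {1..b} h"
      using continuous_on_subset[of "{1..}" h "{1..b}"] by simp
    then show ?thesis
      using IVT'[of h 1 y b] b that \<open>h 1 = 1\<close> by auto
  qed
  consider "x = 0" | "0 < x" "x < 1" | "x \<ge> 1" using \<open>x \<ge> 0\<close> by linarith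
  then show ?thesis
  proof cases
    case 1
    then show ?thesis using h unfolding weight_function_def by auto
  next
    case 2
    then obtain t where "t \<ge> 1" "h t = 1 / x" using ge1[of "1 / x"] by auto
    then show ?thesis
      using weight_function_inverse[OF h, of t] by (intro exI[of _ "1 / t"]) auto
  next
    case 3
    then obtain t where "t \<ge> 1" "h t = x" using ge1 by blast
    then show ?thesis by (intro exI[of _ t]) auto
  qed
qed

lemma
  assumes h: "weight_function h" and "x \<ge> 0"
  shows weight_inv_nonneg: "weight_inv h x \<ge> 0"
    and weight_function_weight_inv: "h (weight_inv h x) = x"
proof -
  have inj: "inj_on h {0..}"
    using weight_function_strict_mono[OF h] by (rule strict_mono_on_imp_inj_on)
  have "x \<in> h ` {0..}" using weight_function_surj[OF assms] by force
  then show "weight_inv h x \<ge> 0" "h (weight_inv h x) = x"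
    using the_inv_into_into[OF inj, of x "{0..}"] f_the_inv_into_f[OF inj, of x]
    unfolding weight_inv_def by auto
qed

text \<open>This adjunction turns bounds on weighted sizes into coordinatewise bounds.\<close>

lemma weight_inv_le_iff:
  assumes "weight_function h" "x \<ge> 0" "t \<ge> 0"
  shows "weight_inv h x \<le> t \<longleftrightarrow> x \<le> h t"
  using weight_function_mono[OF assms(1), of "weight_inv h x" t]
    strict_mono_onD[OF weight_function_strict_mono[OF assms(1)], of t "weight_inv h x"]
    weight_inv_nonneg[OF assms(1,2)] weight_function_weight_inv[OF assms(1,2)] assms(3)
  by force

text \<open>Iterating the lower quasimultiplicative bound \<open>r\<close> times gains the factor
  \<open>c\<^sub>1 ^ r > C\<close> and costs a factor \<open>M ^ r\<close> in the argument. One more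
  factor \<open>M\<close> pays for rounding \<open>t\<close> up to a power of \<open>M\<close>,
  hence the threshold \<open>1 / M ^ Suc r\<close> for \<epsilon>.\<close>

lemma quasimultiplicative_weight_growth:
  assumes h: "weight_function h" and q: "quasimultiplicative h"
  shows "\<exists>\<epsilon>\<^sub>0>0. \<exists>T\<^sub>0. \<forall>\<epsilon> t. 0 < \<epsilon> \<longrightarrow> \<epsilon> \<le> \<epsilon>\<^sub>0 \<longrightarrow> T\<^sub>0 \<le> t \<longrightarrow> C * h t \<le> h (t / \<epsilon>)"
proof -
  obtain M c\<^sub>1 K where M: "M > 1" and c: "1 < c\<^sub>1"
    and K: "\<And>k::int. \<bar>k\<bar> \<ge> K \<Longrightarrow> c\<^sub>1 * h (M powi k) \<le> h (M powi (k + 1))"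
    using q unfolding quasimultiplicative_def by blast
  define N where "N = nat \<bar>K\<bar>"
  have step: "c\<^sub>1 * h (M ^ k) \<le> h (M ^ Suc k)" if "k \<ge> N" for k :: nat
  proof -
    have "M powi (int k + 1) = M ^ Suc k"
      using power_int_of_nat[of M "Suc k"] by (simp add: add.commute)
    then show ?thesis
      using K[of "int k"] that unfolding N_def by simp
  qed
  have steps: "c\<^sub>1 ^ j * h (M ^ k) \<le> h (M ^ (k + j))" if "k \<ge> N" for j k :: nat
  proof (induction j)
    case (Suc j)
    have "c\<^sub>1 ^ Suc j * h (M ^ k) \<le> c\<^sub>1 * h (M ^ (k + j))"
      using Suc c by simp
    also have "\<dots> \<le> h (M ^ (k + Suc j))" using step[of "k + j"] that by simp
    finally show ?case .
  qed simp
  obtain r where r: "C < c\<^sub>1 ^ r" using real_arch_pow[OF c] by blast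
  have "C * h t \<le> h (t / \<epsilon>)" if \<epsilon>: "0 < \<epsilon>" "\<epsilon> \<le> 1 / M ^ Suc r" and t: "M ^ N \<le> t" for \<epsilon> t
  proof -
    have "M ^ N > 0" using M by simp
    then have "t > 0" using t by linarith
    define P where "P k \<longleftrightarrow> t < M ^ k" for k
    \<comment> \<open>The least such exponent gives \<open>M ^ (l - 1) \<le> t < M ^ l\<close>; the
      assumption \<open>M ^ N \<le> t\<close> forces \<open>l > N\<close>, so \<open>l - 1\<close>
      is a genuine predecessor and \<open>steps\<close> applies from \<open>l\<close>.\<close>
    define l where "l = (LEAST k. P k)"
    obtain k0 where "P k0" unfolding P_def using real_arch_pow[OF M] by blast
    then have Pl: "t < M ^ l" using LeastI[of P k0] unfolding l_def P_def by simp
    then have "M ^ N < M ^ l" using t by linarith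
    then have "N < l" using M by simp
    then have "\<not> P (l - 1)" using not_less_Least[of "l - 1" P] unfolding l_def by simp
    then have "M ^ (l - 1) \<le> t" unfolding P_def by simp
    have "C * h t \<le> c\<^sub>1 ^ r * h t"
      using r weight_function_pos[OF h \<open>t > 0\<close>] by simp
    also have "\<dots> \<le> c\<^sub>1 ^ r * h (M ^ l)"
      using Pl \<open>t > 0\<close> c by (intro mult_left_mono weight_function_mono[OF h]) auto
    also have "\<dots> \<le> h (M ^ (l + r))" using steps[of l r] \<open>N < l\<close> by simp
    also have "\<dots> \<le> h (t / \<epsilon>)"
    proof (rule weight_function_mono[OF h])
      have "M ^ (l + r) = M ^ (l - 1) * M ^ Suc r"
        using \<open>N < l\<close> by (cases l) (simp_all add: power_add)
      also have "\<dots> \<le> t * (1 / \<epsilon>)"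
        using \<open>M ^ (l - 1) \<le> t\<close> \<epsilon> M \<open>t > 0\<close>
        by (intro mult_mono) (auto simp: field_simps)
      finally show "M ^ (l + r) \<le> t / \<epsilon>" by simp
    qed (use M in auto)
    finally show ?thesis .
  qed
  moreover have "1 / M ^ Suc r > 0" using M by simp
  ultimately show ?thesis by blast
qed

section \<open>Weighted sizes and distances to the integer lattice\<close>

lemma weighted_size_le_iff:
  fixes \<alpha> :: "'k::finite \<Rightarrow> real \<Rightarrow> real"
  assumes "\<And>i. weight_function (\<alpha> i)" "t \<ge> 0"
  shows "weighted_size \<alpha> y \<le> t \<longleftrightarrow> (\<forall>i. \<bar>y $ i\<bar> \<le> \<alpha> i t)"
  unfolding weighted_size_def using weight_inv_le_iff[OF assms(1) _ assms(2)] by (subst Max_le_iff) auto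

lemma weighted_size_nonneg:
  fixes \<alpha> :: "'k::finite \<Rightarrow> real \<Rightarrow> real"
  assumes "\<And>i. weight_function (\<alpha> i)"
  shows "weighted_size \<alpha> y \<ge> 0"
  unfolding weighted_size_def
  using weight_inv_nonneg[OF assms abs_ge_zero] by (subst Max_ge_iff) auto

text \<open>Rounding each coordinate minimises all the \<open>\<bar>x $ j - p $ j\<bar>\<close> at
  once, hence also the maximum of increasing functions of them.\<close>

lemma weighted_dist_int_attained:
  fixes \<beta> :: "'k::finite \<Rightarrow> real \<Rightarrow> real"
  assumes "\<And>j. weight_function (\<beta> j)"
  shows "\<exists>p. weighted_size \<beta> (x - real_vec p) \<le> weighted_dist_int \<beta> x"
proof -
  define p :: "int ^ 'k" where "p = (\<chi> j. round (x $ j))"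
  have "weighted_size \<beta> (x - real_vec p) \<le> weighted_size \<beta> (x - real_vec p')" for p'
  proof (subst weighted_size_le_iff[of \<beta>, OF assms weighted_size_nonneg[of \<beta>, OF assms]], intro allI)
    fix j
    have "\<bar>(x - real_vec p) $ j\<bar> \<le> \<bar>(x - real_vec p') $ j\<bar>"
      using round_diff_minimal[of "x $ j" "p' $ j"] by (simp add: p_def real_vec_def)
    also have "\<dots> \<le> \<beta> j (weighted_size \<beta> (x - real_vec p'))"
      using weighted_size_le_iff[of \<beta>, OF assms weighted_size_nonneg[of \<beta>, OF assms]] by blast
    finally show "\<bar>(x - real_vec p) $ j\<bar> \<le> \<beta> j (weighted_size \<beta> (x - real_vec p'))" .
  qed
  then show ?thesis
    unfolding weighted_dist_int_def by (intro exI[of _ p] cINF_greatest) auto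
qed

text \<open>Such integer vectors lie in a bounded box. Consequently an infinite set of
  approximations stays infinite after its small members are discarded.\<close>

lemma finite_weighted_size_le:
  fixes \<alpha> :: "'k::finite \<Rightarrow> real \<Rightarrow> real"
  assumes "\<And>i. weight_function (\<alpha> i)"
  shows "finite {y :: int ^ 'k. weighted_size \<alpha> (real_vec y) \<le> R}"
proof (cases "R \<ge> 0")
  case True
  define A where "A i = {- \<lceil>\<alpha> i R\<rceil>..\<lceil>\<alpha> i R\<rceil>}" for i
  have "{y :: int ^ 'k. weighted_size \<alpha> (real_vec y) \<le> R} \<subseteq> vec_lambda ` (Pi\<^sub>E UNIV A)"
  proof safe
    fix y :: "int ^ 'k"
    assume "weighted_size \<alpha> (real_vec y) \<le> R"
    then have "real_of_int \<bar>y $ i\<bar> \<le> \<alpha> i R" for i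
      using weighted_size_le_iff[of \<alpha>, OF assms True] by (simp add: real_vec_def)
    then have "\<bar>y $ i\<bar> \<le> \<lceil>\<alpha> i R\<rceil>" for i
      by (metis ceiling_mono ceiling_of_int)
    then have "vec_nth y \<in> Pi\<^sub>E UNIV A"
      by (auto simp: A_def abs_le_iff minus_le_iff)
    then show "y \<in> vec_lambda ` (Pi\<^sub>E UNIV A)"
      by (metis image_eqI vec_nth_inverse)
  qed
  moreover have "finite (Pi\<^sub>E UNIV A)" by (rule finite_PiE) (auto simp: A_def)
  ultimately show ?thesis by (metis finite_imageI finite_subset)
next
  case False
  then have "{y :: int ^ 'k. weighted_size \<alpha> (real_vec y) \<le> R} = {}"
    using weighted_size_nonneg[of \<alpha>, OF assms] by (force simp: not_le intro: less_le_trans)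
  then show ?thesis by simp
qed


section \<open>Orthogonality of characters\<close>

text \<open>Fubini: \<open>lborel\<close> is the image of the product of one-dimensional Lebesgue
  measures under the coordinate map.\<close>

lemma integral_lborel_prod:
  fixes f :: "'a::euclidean_space \<Rightarrow> real \<Rightarrow> complex"
  assumes f: "\<And>b. b \<in> Basis \<Longrightarrow> integrable lborel (f b)"
  shows "(\<integral>x. (\<Prod>b\<in>Basis. f b (x \<bullet> b)) \<partial>lborel) = (\<Prod>b\<in>Basis. \<integral>t. f b t \<partial>lborel)"
proof -
  interpret product_sigma_finite "\<lambda>_::'a. lborel :: real measure"
    by standard
  have [measurable]: "f b \<in> borel_measurable borel" if "b \<in> Basis" for b
    using borel_measurable_integrable[OF f[OF that]] by simp
  have "(\<integral>x. (\<Prod>b\<in>Basis. f b (x \<bullet> b)) \<partial>lborel) =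
      (\<integral>x. (\<Prod>b\<in>Basis. f b ((\<Sum>c\<in>Basis. x c *\<^sub>R c) \<bullet> b)) \<partial>(\<Pi>\<^sub>M b\<in>Basis. lborel))"
    by (subst lborel_eq, subst integral_distr) auto
  also have "\<dots> = (\<integral>x. (\<Prod>b\<in>Basis. f b (x b)) \<partial>(\<Pi>\<^sub>M b\<in>Basis. lborel))"
    by (intro Bochner_Integration.integral_cong prod.cong refl) simp
  also have "\<dots> = (\<Prod>b\<in>Basis. \<integral>t. f b t \<partial>lborel)"
    by (rule product_integral_prod) (use f in auto)
  finally show ?thesis .
qed

text \<open>The interval has integer endpoints, at which the antiderivative \<open>F\<close> takes
  the same value.\<close>

lemma integral_cis_period:
  fixes N :: nat and k :: int
  assumes "k \<noteq> 0"
  shows "(\<integral>t. indicator {-real N..real N} t *\<^sub>R cis (2 * pi * of_int k * t) \<partial>lborel) = 0"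
proof -
  define c where "c = 2 * pi * real_of_int k"
  define F where "F t = cis (c * t) / (\<i> * of_real c)" for t
  have "c \<noteq> 0" using assms by (simp add: c_def)
  have F: "(F has_vector_derivative cis (c * t)) (at t within A)" for t A
  proof -
    have "((\<lambda>t. cis (c * t)) has_vector_derivative c *\<^sub>R (\<i> * cis (c * t))) (at t within A)"
    proof -
      \<comment> \<open>The derivative is taken for the entire function of a complex variable and
        then restricted to the real line.\<close>
      have "((\<lambda>z. exp (\<i> * (of_real c * z))) has_field_derivative
          c *\<^sub>R (\<i> * cis (c * t))) (at (of_real t))"
        by (auto intro!: derivative_eq_intros simp: scaleR_conv_of_real cis_conv_exp)
      from has_vector_derivative_real_field[OF this] show ?thesis by (simp add: cis_conv_exp)
    qed
    from has_vector_derivative_divide[OF this, of "\<i> * of_real c"] show ?thesis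
      using \<open>c \<noteq> 0\<close> unfolding F_def[abs_def] by (simp add: scaleR_conv_of_real)
  qed
  have "(\<integral>t. indicator {-real N..real N} t *\<^sub>R cis (c * t) \<partial>lborel) = F (real N) - F (- real N)"
    by (rule integral_FTC_Icc) (auto intro!: F continuous_intros)
  also have "cis (c * real N) = 1" "cis (c * - real N) = 1"
    using cis_multiple_2pi[of "of_int (k * int N)"] cis_multiple_2pi[of "of_int (- (k * int N))"]
    by (simp_all add: c_def mult_ac)
  then have "F (real N) - F (- real N) = 0" by (simp add: F_def)
  finally show ?thesis by (simp add: c_def)
qed

text \<open>The character of frequency \<open>w\<close> factors over the coordinates, and a
  coordinate with \<open>w \<bullet> b \<noteq> 0\<close> contributes a vanishing one-dimensional
  integral. The cosine is the real part.\<close>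

lemma integral_cos_period:
  fixes w :: "'a::euclidean_space" and N :: nat
  assumes w: "\<And>b. b \<in> Basis \<Longrightarrow> w \<bullet> b \<in> \<int>" and "w \<noteq> 0"
  shows "(\<integral>x. indicator (cbox (- (real N *\<^sub>R One)) (real N *\<^sub>R One)) x *\<^sub>R cos (2 * pi * (w \<bullet> x)) \<partial>lborel) = 0"
proof -
  define K :: "'a set" where "K = cbox (- (real N *\<^sub>R One)) (real N *\<^sub>R One)"
  define g where "g b t = indicator {-real N..real N} t *\<^sub>R cis (2 * pi * (w \<bullet> b) * t)" for b :: 'a and t
  have g_int: "integrable lborel (g b)" for b
    unfolding g_def[abs_def] by (rule borel_integrable_compact) (auto intro!: continuous_intros)
  have K_iff: "x \<in> K \<longleftrightarrow> (\<forall>b\<in>Basis. x \<bullet> b \<in> {-real N..real N})" for x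
    unfolding K_def by (auto simp: mem_box inner_sum_left_Basis)
  have g_prod: "(\<Prod>b\<in>Basis. g b (x \<bullet> b)) = indicator K x *\<^sub>R cis (2 * pi * (w \<bullet> x))" for x
  proof (cases "x \<in> K")
    case True
    then have "(\<Prod>b\<in>Basis. g b (x \<bullet> b)) = (\<Prod>b\<in>Basis. exp (\<i> * of_real (2 * pi * (w \<bullet> b) * (x \<bullet> b))))"
      using K_iff by (intro prod.cong) (auto simp: g_def cis_conv_exp)
    also have "\<dots> = exp (\<Sum>b\<in>Basis. \<i> * of_real (2 * pi * (w \<bullet> b) * (x \<bullet> b)))"
      by (simp add: exp_sum)
    also have "(\<Sum>b\<in>Basis. \<i> * of_real (2 * pi * (w \<bullet> b) * (x \<bullet> b))) = \<i> * of_real (2 * pi * (w \<bullet> x))"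
      by (subst euclidean_inner[of w x]) (simp add: sum_distrib_left mult_ac)
    finally show ?thesis using True by (simp add: cis_conv_exp)
  next
    case False
    then obtain b where "b \<in> Basis" "x \<bullet> b \<notin> {-real N..real N}" using K_iff by blast
    then have "g b (x \<bullet> b) = 0" by (simp add: g_def)
    then show ?thesis using \<open>b \<in> Basis\<close> False by (auto intro!: prod_zero)
  qed
  obtain b where b: "b \<in> Basis" "w \<bullet> b \<noteq> 0"
    using \<open>w \<noteq> 0\<close> by (auto simp: euclidean_eq_iff[of w 0])
  obtain k where k: "w \<bullet> b = of_int k" using w[OF b(1)] by (auto elim: Ints_cases)
  have "(\<integral>t. g b t \<partial>lborel) = 0"
    using integral_cis_period[of k N] b k unfolding g_def by simp
  then have zero: "(\<integral>x. indicator K x *\<^sub>R cis (2 * pi * (w \<bullet> x)) \<partial>lborel) = 0"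
    using integral_lborel_prod[of g] g_int b(1) by (auto simp: g_prod intro!: prod_zero)
  have "integrable lborel (\<lambda>x. indicator K x *\<^sub>R cis (2 * pi * (w \<bullet> x)))"
    unfolding K_def by (rule borel_integrable_compact) (auto intro!: continuous_intros)
  from integral_Re[OF this] zero
  have "(\<integral>x. Re (indicator K x *\<^sub>R cis (2 * pi * (w \<bullet> x))) \<partial>lborel) = 0" by simp
  then show ?thesis by (simp add: K_def)
qed

section \<open>Points where infinitely many characters have real part above a positive
  constant\<close>

lemma real_vec_inner_Basis_Ints:
  fixes y z :: "int ^ 'k::finite"
  assumes "b \<in> Basis"
  shows "(real_vec y - real_vec z) \<bullet> b \<in> \<int>"
  using assms by (auto simp: Basis_vec_def inner_axis real_vec_def)

lemma real_vec_eq_iff: "real_vec y = real_vec z \<longleftrightarrow> y = z"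
  by (auto simp: real_vec_def vec_eq_iff)

text \<open>By orthogonality, a sum of \<open>k\<close> distinct characters has mean square \<open>1\<close> per character on a
  period cube, while on the set below it is at least \<open>k * c\<close>; hence the set has measure
  \<open>O(1 / k)\<close> there for every \<open>k\<close>.\<close>

lemma null_sets_cos_ge:
  fixes S :: "(int ^ 'k::finite) set" and c :: real
  assumes S: "infinite S" and c: "c > 0"
  shows "{\<eta>. \<forall>y\<in>S. c \<le> cos (2 * pi * (real_vec y \<bullet> \<eta>))} \<in> null_sets lborel" (is "?F \<in> _")
proof -
  have "closed ?F"
    unfolding Collect_ball_eq by (intro closed_INT ballI closed_Collect_le continuous_intros)
  define K :: "nat \<Rightarrow> (real ^ 'k) set" where "K N = cbox (- (real N *\<^sub>R One)) (real N *\<^sub>R One)" for N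
  have "?F \<inter> K N \<in> null_sets lborel" for N
  proof -
    define A where "A = ?F \<inter> K N"
    have A: "compact A" unfolding A_def K_def using \<open>closed ?F\<close> by (intro closed_Int_compact) auto
    then have [measurable]: "A \<in> sets borel" by (simp add: borel_compact)
    have finA: "emeasure lborel A < \<infinity>" using A by (rule emeasure_compact_finite)
    have K: "compact (K N)" by (simp add: K_def)
    have bound: "real k * (c\<^sup>2 * measure lborel A) \<le> measure lborel (K N)" if "k > 0" for k
    proof -
      obtain Y where Y: "Y \<subseteq> S" "finite Y" "card Y = k"
        using infinite_arbitrarily_large[OF S] by blast
      \<comment> \<open>\<open>P\<close> is the squared modulus of the sum of the characters with
        frequencies in \<open>Y\<close>. The double sum is suited to integration, the sum of two
        squares below to the lower bound on \<open>A\<close>.\<close>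
      define P where "P x = (\<Sum>y\<in>Y. \<Sum>z\<in>Y. cos (2 * pi * ((real_vec y - real_vec z) \<bullet> x)))" for x :: "real ^ 'k"
      have P: "P x = (\<Sum>y\<in>Y. cos (2 * pi * (real_vec y \<bullet> x)))\<^sup>2 + (\<Sum>y\<in>Y. sin (2 * pi * (real_vec y \<bullet> x)))\<^sup>2" for x
        unfolding P_def power2_eq_square sum_product
        by (simp add: inner_diff_left right_diff_distrib cos_diff sum.distrib)
      have int_correlation: "integrable lborel (\<lambda>x. indicator (K N) x *\<^sub>R cos (2 * pi * ((real_vec y - real_vec z) \<bullet> x)))" for y z :: "int ^ 'k"
        by (rule borel_integrable_compact[OF K]) (intro continuous_intros)
      have int_P: "integrable lborel (\<lambda>x. indicator (K N) x *\<^sub>R P x)"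
        unfolding P_def by (rule borel_integrable_compact[OF K]) (intro continuous_intros)
      have correlation: "(\<integral>x. indicator (K N) x *\<^sub>R cos (2 * pi * ((real_vec y - real_vec z) \<bullet> x)) \<partial>lborel)
          = (if y = z then measure lborel (K N) else 0)" for y z :: "int ^ 'k"
        using integral_cos_period[OF real_vec_inner_Basis_Ints, of y z N]
        by (auto simp: real_vec_eq_iff K_def)
      have "(real k * c)\<^sup>2 * measure lborel A = (\<integral>x. indicator A x *\<^sub>R (real k * c)\<^sup>2 \<partial>lborel)"
        by simp
      also have "\<dots> \<le> (\<integral>x. indicator (K N) x *\<^sub>R P x \<partial>lborel)"
      proof (rule integral_mono[OF _ int_P])
        show "integrable lborel (\<lambda>x. indicator A x *\<^sub>R (real k * c)\<^sup>2)"
          by (rule borel_integrable_compact[OF A]) simp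
        fix x
        have "P x \<ge> 0" using P by simp
        moreover have "(real k * c)\<^sup>2 \<le> P x" if "x \<in> A"
        proof -
          have "(\<Sum>y\<in>Y. c) \<le> (\<Sum>y\<in>Y. cos (2 * pi * (real_vec y \<bullet> x)))"
            using that Y by (intro sum_mono) (auto simp: A_def)
          then have "(real k * c)\<^sup>2 \<le> (\<Sum>y\<in>Y. cos (2 * pi * (real_vec y \<bullet> x)))\<^sup>2"
            using c Y by (intro power_mono) auto
          then show ?thesis using P by (simp add: add_increasing2)
        qed
        ultimately show "indicator A x *\<^sub>R (real k * c)\<^sup>2 \<le> indicator (K N) x *\<^sub>R P x"
          by (auto simp: A_def split: split_indicator)
      qed
      also have "\<dots> = (\<Sum>y\<in>Y. \<Sum>z\<in>Y. \<integral>x. indicator (K N) x *\<^sub>R cos (2 * pi * ((real_vec y - real_vec z) \<bullet> x)) \<partial>lborel)"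
        unfolding P_def scaleR_sum_right using int_correlation
        by (subst Bochner_Integration.integral_sum; (intro sum.cong refl Bochner_Integration.integral_sum integrable_sum)?; simp)
      \<comment> \<open>Orthogonality leaves only the \<open>k\<close> diagonal pairs, so the right
        side grows linearly in \<open>k\<close> while the left side grows quadratically.\<close>
      also have "\<dots> = real k * measure lborel (K N)"
        unfolding correlation using Y by simp
      finally show ?thesis using that by (simp add: power2_eq_square mult_ac)
    qed
    have "measure lborel A = 0"
    proof (rule ccontr)
      assume "measure lborel A \<noteq> 0"
      then have "c\<^sup>2 * measure lborel A > 0" using c by (simp add: zero_less_measure_iff)
      then obtain k where k: "measure lborel (K N) < real k * (c\<^sup>2 * measure lborel A)"
        using reals_Archimedean3 by blast
      then have "k > 0" using measure_nonneg[of lborel "K N"] by (cases k) auto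
      then show False using bound[of k] k by linarith
    qed
    then have "emeasure lborel A = 0"
      using emeasure_eq_ennreal_measure[of lborel A] finA by (simp add: less_top)
    then have "A \<in> null_sets lborel" using \<open>A \<in> sets borel\<close> by (intro null_setsI) auto
    then show ?thesis by (simp only: A_def)
  qed
  then have "(\<Union>N. ?F \<inter> K N) \<in> null_sets lborel" by (rule null_sets_UN)
  moreover have "(\<Union>N. ?F \<inter> K N) = ?F"
  proof -
    have "\<exists>N. x \<in> K N" for x
    proof -
      obtain N :: nat where N: "norm x \<le> real N" using real_arch_simple by blast
      have "\<bar>x \<bullet> b\<bar> \<le> real N" if "b \<in> Basis" for b
        using Basis_le_norm[OF that, of x] N by linarith
      then show ?thesis
        by (intro exI[of _ N]) (auto simp: K_def mem_box abs_le_iff minus_le_iff)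
    qed
    then show ?thesis by blast
  qed
  ultimately show ?thesis by simp
qed

section \<open>Transference\<close>

text \<open>Expanding the pairing of \<open>y\<close> with \<open>\<Theta> *v real_vec q\<close> in
  two ways writes \<open>real_vec y \<bullet> \<eta>\<close> as an integer plus one small error term
  for each coordinate of \<open>y\<close> and of \<open>q\<close>.\<close>

lemma inner_near_int_transference:
  fixes \<Theta> :: "real ^ 'm::finite ^ 'n::finite" and y r :: "int ^ 'n" and q p :: "int ^ 'm"
  assumes 1: "\<And>i. real_of_int \<bar>y $ i\<bar> * \<bar>(\<Theta> *v real_vec q) $ i - \<eta> $ i - of_int (r $ i)\<bar> \<le> \<delta>"
    and 2: "\<And>j. real_of_int \<bar>q $ j\<bar> * \<bar>(transpose \<Theta> *v real_vec y) $ j - of_int (p $ j)\<bar> \<le> \<delta>"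
  shows "\<exists>k::int. \<bar>real_vec y \<bullet> \<eta> - of_int k\<bar> \<le> real (CARD('n) + CARD('m)) * \<delta>"
proof -
  define k where "k = (\<Sum>j\<in>UNIV. q $ j * p $ j) - (\<Sum>i\<in>UNIV. y $ i * r $ i)"
  define u where "u = (\<Sum>i\<in>UNIV. real_of_int (y $ i) * ((\<Theta> *v real_vec q) $ i - \<eta> $ i - of_int (r $ i)))"
  define v where "v = (\<Sum>j\<in>UNIV. real_of_int (q $ j) * ((transpose \<Theta> *v real_vec y) $ j - of_int (p $ j)))"
  have "real_vec y \<bullet> (\<Theta> *v real_vec q) = real_vec q \<bullet> (transpose \<Theta> *v real_vec y)"
    by (simp add: transpose_matrix_vector dot_lmul_matrix inner_commute flip: dot_lmul_matrix)
  then have dual: "(\<Sum>i\<in>UNIV. of_int (y $ i) * (\<Theta> *v real_vec q) $ i) =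
      (\<Sum>j\<in>UNIV. of_int (q $ j) * (transpose \<Theta> *v real_vec y) $ j)"
    by (simp add: inner_vec_def real_vec_def)
  have "real_vec y \<bullet> \<eta> - of_int k = v - u"
    using dual unfolding u_def v_def k_def
    by (simp add: inner_vec_def real_vec_def right_diff_distrib sum_subtractf)
  moreover have "\<bar>u\<bar> \<le> (\<Sum>i\<in>(UNIV::'n set). \<delta>)"
    unfolding u_def by (rule order_trans[OF sum_abs sum_mono]) (use 1 in \<open>simp add: abs_mult\<close>)
  moreover have "\<bar>v\<bar> \<le> (\<Sum>j\<in>(UNIV::'m set). \<delta>)"
    unfolding v_def by (rule order_trans[OF sum_abs sum_mono]) (use 2 in \<open>simp add: abs_mult\<close>)
  ultimately have "\<bar>real_vec y \<bullet> \<eta> - of_int k\<bar> \<le> real (CARD('n) + CARD('m)) * \<delta>"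
    by (simp add: algebra_simps)
  then show ?thesis ..
qed

lemma cos_ge_half_near_int:
  assumes "\<bar>x - of_int k\<bar> \<le> 1 / 6"
  shows "cos (2 * pi * x) \<ge> 1 / 2"
proof -
  define d where "d = x - of_int k"
  have "cos (2 * pi * x) = cos (2 * pi * d + 2 * pi * of_int k)"
    by (simp add: d_def algebra_simps)
  also have "\<dots> = cos (2 * pi * d)"
    by (simp add: cos_add mult.commute[of pi])
  also have "\<dots> = cos \<bar>2 * pi * d\<bar>" by simp
  also have "\<dots> \<ge> cos (pi / 3)"
    using assms by (intro cos_monotone_0_pi_le) (auto simp: d_def abs_mult)
  finally show ?thesis by (simp add: cos_60)
qed

text \<open>Distance zero in every coordinate means that \<eta> differs from
  \<open>\<Theta> *v real_vec q\<close> by an integer vector, which leaves countably many choices.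
  This serves the case of \<open>f\<close> bounded away from 0.\<close>

lemma countable_integer_orbit:
  fixes \<Theta> :: "real ^ 'm::finite ^ 'n::finite"
  shows "countable {\<eta>. \<exists>q :: int ^ 'm. \<forall>i. dist_nearest_int ((\<Theta> *v real_vec q) $ i - \<eta> $ i) \<le> 0}" (is "countable ?D")
proof -
  have "?D \<subseteq> (\<lambda>(q :: int ^ 'm, r :: int ^ 'n). \<Theta> *v real_vec q - real_vec r) ` UNIV"
  proof safe
    fix \<eta> :: "real ^ 'n" and q :: "int ^ 'm"
    assume "\<forall>i. dist_nearest_int ((\<Theta> *v real_vec q) $ i - \<eta> $ i) \<le> 0"
    then have "\<eta> = \<Theta> *v real_vec q - real_vec (\<chi> i. round ((\<Theta> *v real_vec q) $ i - \<eta> $ i))"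
      by (simp add: dist_nearest_int_def vec_eq_iff real_vec_def algebra_simps)
    then show "\<eta> \<in> (\<lambda>(q :: int ^ 'm, r :: int ^ 'n). \<Theta> *v real_vec q - real_vec r) ` UNIV"
      by (metis (mono_tags, lifting) UNIV_I case_prod_conv image_eqI)
  qed
  then show ?thesis by (rule countable_subset) simp
qed

lemma dual_rate_eq:
  assumes "strict_antimono_on {0<..} f" "Y > 0"
  shows "dual_rate f (1 / f Y) = 1 / Y"
proof -
  have "inj_on f {0<..}"
    using assms(1) by (intro linorder_inj_onI) (fastforce simp: monotone_on_def)+
  then show ?thesis
    using assms(2) by (simp add: dual_rate_def the_inv_into_f_f)
qed

theorem theorem1p3:
  fixes \<alpha> :: "'n::finite \<Rightarrow> real \<Rightarrow> real"
    and \<beta> :: "'m::finite \<Rightarrow> real \<Rightarrow> real"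
    and \<Theta> :: "real ^ 'm ^ 'n"
    and f :: "real \<Rightarrow> real"
  assumes "\<And>i. weight_function (\<alpha> i)" and "\<And>i. quasimultiplicative (\<alpha> i)"
    and "\<And>j. weight_function (\<beta> j)" and "\<And>j. quasimultiplicative (\<beta> j)"
    and "\<And>t. t > 0 \<Longrightarrow> f t > 0"
    and "continuous_on {0<..} f"
    and "strict_antimono_on {0<..} f"
    and "approximable f \<beta> \<alpha> (transpose \<Theta>)"
  shows "\<exists>\<epsilon>\<^sub>0>0. \<forall>\<epsilon>. 0 < \<epsilon> \<and> \<epsilon> < \<epsilon>\<^sub>0 \<longrightarrow>
    {\<eta> :: real ^ 'n. dirichlet (\<lambda>T. \<epsilon> * dual_rate f (T / \<epsilon>)) \<alpha> \<beta> \<Theta> \<eta>} \<in> null_sets lebesgue"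
proof -
  \<comment> \<open>Each of the n + m error terms will be at most \<open>1 / C\<close>, for a total
    of 1/6, one sixth of a period; there the cosine is still at least 1/2.\<close>
  define C where "C = 6 * real (CARD('n) + CARD('m))"
  have C: "C > 0" by (simp add: C_def add_pos_pos)
  obtain ea Ta where a: "\<And>i. ea i > 0"
    "\<And>i \<epsilon> t. 0 < \<epsilon> \<Longrightarrow> \<epsilon> \<le> ea i \<Longrightarrow> Ta i \<le> t \<Longrightarrow> C * \<alpha> i t \<le> \<alpha> i (t / \<epsilon>)"
    using quasimultiplicative_weight_growth[OF assms(1,2), where C = C] by metis
  obtain eb Tb where b: "\<And>j. eb j > 0"
    "\<And>j \<epsilon> t. 0 < \<epsilon> \<Longrightarrow> \<epsilon> \<le> eb j \<Longrightarrow> Tb j \<le> t \<Longrightarrow> C * \<beta> j t \<le> \<beta> j (t / \<epsilon>)"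
    using quasimultiplicative_weight_growth[OF assms(3,4), where C = C] by metis
  define \<epsilon>\<^sub>0 where "\<epsilon>\<^sub>0 = Min (range ea \<union> range eb)"
  have "\<epsilon>\<^sub>0 > 0" unfolding \<epsilon>\<^sub>0_def using a(1) b(1) by (subst Min_gr_iff) auto
  have \<epsilon>\<^sub>0_le: "\<epsilon>\<^sub>0 \<le> ea i" "\<epsilon>\<^sub>0 \<le> eb j" for i j unfolding \<epsilon>\<^sub>0_def by (auto intro!: Min_le)
  \<comment> \<open>Inserting 1 keeps the threshold positive.\<close>
  define T\<^sub>0 where "T\<^sub>0 = Max (insert 1 (range Ta \<union> range Tb))"
  have T\<^sub>0: "1 \<le> T\<^sub>0" "Ta i \<le> T\<^sub>0" "Tb j \<le> T\<^sub>0" for i j unfolding T\<^sub>0_def by (rule Max_ge; simp)+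
  have f_anti: "f t < f s" if "0 < s" "s < t" for s t
    using monotone_onD[OF assms(7), of s t] that by simp
  have "{\<eta>. dirichlet (\<lambda>T. \<epsilon> * dual_rate f (T / \<epsilon>)) \<alpha> \<beta> \<Theta> \<eta>} \<in> null_sets lebesgue" (is "?D \<in> _")
    if \<epsilon>: "0 < \<epsilon>" "\<epsilon> < \<epsilon>\<^sub>0" for \<epsilon>
  proof (cases "\<exists>L>0. \<forall>t>0. L \<le> f t")
    case True
    then obtain L where L: "L > 0" "\<And>t. t > 0 \<Longrightarrow> L \<le> f t" by blast
    have \<alpha>0: "\<alpha> i 0 = 0" for i using assms(1)[of i] unfolding weight_function_def by blast
    have "?D \<subseteq> {\<eta>. \<exists>q :: int ^ 'm. \<forall>i. dist_nearest_int ((\<Theta> *v real_vec q) $ i - \<eta> $ i) \<le> 0}"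
    proof safe
      fix \<eta>
      assume "dirichlet (\<lambda>T. \<epsilon> * dual_rate f (T / \<epsilon>)) \<alpha> \<beta> \<Theta> \<eta>"
      then have "\<forall>\<^sub>F T in at_top. T > \<epsilon> / L \<and> (\<exists>q :: int ^ 'm.
          \<forall>i. dist_nearest_int ((\<Theta> *v real_vec q) $ i - \<eta> $ i) \<le> \<alpha> i (\<epsilon> * dual_rate f (T / \<epsilon>)))"
        unfolding dirichlet_def
        by (intro eventually_conj eventually_gt_at_top) (erule eventually_mono, blast)
      then obtain T and q :: "int ^ 'm" where T: "T > \<epsilon> / L"
        and q: "\<And>i. dist_nearest_int ((\<Theta> *v real_vec q) $ i - \<eta> $ i) \<le> \<alpha> i (\<epsilon> * dual_rate f (T / \<epsilon>))"
        using eventually_happens'[OF trivial_limit_at_top_linorder] by blast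
      have "\<epsilon> / L > 0" using \<epsilon> L by simp
      then have "T > 0" using T by linarith
      \<comment> \<open>For such \<open>T\<close> the argument of the inverse lies below the range
        of \<open>f\<close>, so \<open>dual_rate\<close> takes its default value 0 and every
        permitted error is \<open>\<alpha> i 0 = 0\<close>.\<close>
      then have "1 / (T / \<epsilon>) < L" using T L \<epsilon> by (simp add: field_simps)
      then have "1 / (T / \<epsilon>) \<notin> f ` {0<..}" using L(2) by force
      then have "dual_rate f (T / \<epsilon>) = 0" unfolding dual_rate_def by (simp only: if_False)
      then show "\<exists>q :: int ^ 'm. \<forall>i. dist_nearest_int ((\<Theta> *v real_vec q) $ i - \<eta> $ i) \<le> 0"
        using q \<alpha>0 by auto
    qed
    then have "countable ?D" using countable_integer_orbit countable_subset by blast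
    then show ?thesis
      by (intro null_sets_completionI countable_imp_null_set_lborel)
  next
    case False
    define S where "S = {y :: int ^ 'n. y \<noteq> 0 \<and>
       weighted_dist_int \<beta> (transpose \<Theta> *v real_vec y) \<le> f (weighted_size \<alpha> (real_vec y))}"
    have "infinite S" using assms(8) unfolding approximable_def S_def .
    \<comment> \<open>Only the approximations larger than \<open>R\<close> are imposed, because the
      Dirichlet property gives information only beyond a threshold depending on \<eta>. Taking
      natural numbers \<open>R\<close> makes the union countable.\<close>
    define F where "F R = {\<eta> :: real ^ 'n. \<forall>y\<in>S - {y. weighted_size \<alpha> (real_vec y) \<le> real R}.
       1 / 2 \<le> cos (2 * pi * (real_vec y \<bullet> \<eta>))}" for R :: nat
    have "F R \<in> null_sets lborel" for R
      unfolding F_def using \<open>infinite S\<close> finite_weighted_size_le[of \<alpha>, OF assms(1)]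
      by (intro null_sets_cos_ge Diff_infinite_finite) auto
    then have "(\<Union>R. F R) \<in> null_sets lborel" by (rule null_sets_UN)
    then have "(\<Union>R. F R) \<in> null_sets lebesgue" by (rule null_sets_completionI)
    moreover have "?D \<subseteq> (\<Union>R. F R)"
    proof
      fix \<eta>
      assume "\<eta> \<in> ?D"
      then obtain T\<^sub>1 where T\<^sub>1: "\<And>T. T\<^sub>1 \<le> T \<Longrightarrow> \<exists>q :: int ^ 'm. q \<noteq> 0 \<and>
        (\<forall>i. dist_nearest_int ((\<Theta> *v real_vec q) $ i - \<eta> $ i) \<le> \<alpha> i (\<epsilon> * dual_rate f (T / \<epsilon>))) \<and>
        (\<forall>j. real_of_int \<bar>q $ j\<bar> \<le> \<beta> j T)"
        unfolding dirichlet_def eventually_at_top_linorder by blast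
      define T\<^sub>2 where "T\<^sub>2 = max T\<^sub>0 T\<^sub>1"
      have "T\<^sub>2 > 0" using T\<^sub>0(1) unfolding T\<^sub>2_def by linarith
      then have "\<epsilon> / T\<^sub>2 > 0" using \<epsilon> by simp
      \<comment> \<open>Beyond \<open>t\<^sub>0\<close> the value of \<open>f\<close> is below
        \<open>\<epsilon> / T\<^sub>2\<close>, which makes \<open>T = \<epsilon> / f Y\<close>
        exceed both thresholds. The resulting \<open>R\<close> depends on \<eta> but not on
        \<open>y\<close>.\<close>
      then obtain t\<^sub>0 where t\<^sub>0: "t\<^sub>0 > 0" "f t\<^sub>0 < \<epsilon> / T\<^sub>2" using False by (meson not_le)
      obtain R :: nat where R: "max t\<^sub>0 T\<^sub>0 \<le> real R" using real_arch_simple by blast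
      have "1 / 2 \<le> cos (2 * pi * (real_vec y \<bullet> \<eta>))"
        if "y \<in> S" and y: "\<not> weighted_size \<alpha> (real_vec y) \<le> real R" for y
      proof -
        define Y where "Y = weighted_size \<alpha> (real_vec y)"
        \<comment> \<open>This choice gives \<open>dual_rate f (T / \<epsilon>) = 1 / Y\<close>, so
          the inhomogeneous errors are at most \<open>\<alpha> i (\<epsilon> / Y)\<close>; also
          \<open>\<epsilon> / T = f Y\<close>, so the dual errors are at most
          \<open>\<beta> j (\<epsilon> / T)\<close>.\<close>
        define T where "T = \<epsilon> / f Y"
        have Y: "Y > 0" "t\<^sub>0 < Y" "T\<^sub>0 < Y" using y R t\<^sub>0 unfolding Y_def by auto
        have fY: "f Y > 0" using assms(5) Y by blast
        have "f Y < \<epsilon> / T\<^sub>2" using f_anti[OF t\<^sub>0(1) Y(2)] t\<^sub>0(2) by linarith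
        then have "T\<^sub>2 \<le> T" using \<open>T\<^sub>2 > 0\<close> fY \<epsilon> unfolding T_def by (simp add: field_simps)
        then have T: "T\<^sub>0 \<le> T" "T\<^sub>1 \<le> T" "T > 0" using T\<^sub>0(1) unfolding T\<^sub>2_def by auto
        have T\<epsilon>: "T / \<epsilon> = 1 / f Y" using \<epsilon> unfolding T_def by simp
        obtain q :: "int ^ 'm" where
          q: "\<And>i. dist_nearest_int ((\<Theta> *v real_vec q) $ i - \<eta> $ i) \<le> \<alpha> i (\<epsilon> / Y)"
             "\<And>j. real_of_int \<bar>q $ j\<bar> \<le> \<beta> j T"
          using T\<^sub>1[OF T(2)] dual_rate_eq[OF assms(7) Y(1)] T\<epsilon> by auto
        define r :: "int ^ 'n" where "r = (\<chi> i. round ((\<Theta> *v real_vec q) $ i - \<eta> $ i))"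
        obtain p where p: "weighted_size \<beta> (transpose \<Theta> *v real_vec y - real_vec p) \<le> f Y"
          using weighted_dist_int_attained[of \<beta> "transpose \<Theta> *v real_vec y", OF assms(3)] \<open>y \<in> S\<close>
          unfolding S_def Y_def by (auto intro: order_trans)
        \<comment> \<open>The reciprocal law bounds the product by
          \<open>h t / h (t / \<epsilon>)\<close>, which the growth estimate controls. It is applied
          to \<open>\<alpha> i\<close> at \<open>Y\<close> and to \<open>\<beta> j\<close> at
          \<open>T\<close>.\<close>
        have ratio: "u * v \<le> 1 / C"
          if h: "weight_function h" and "C * h t \<le> h (t / \<epsilon>)" "0 < t"
            "0 \<le> u" "0 \<le> v" "u \<le> h t" "v \<le> h (\<epsilon> / t)" for h u v t
        proof -
          have pos: "h t > 0" "h (t / \<epsilon>) > 0" using weight_function_pos[OF h] that \<epsilon> by auto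
          have "h (\<epsilon> / t) = 1 / h (t / \<epsilon>)"
            using weight_function_inverse[OF h, of "t / \<epsilon>"] that \<epsilon> by simp
          then have "u * v \<le> h t * (1 / h (t / \<epsilon>))"
            using that pos by (intro mult_mono) auto
          also have "\<dots> \<le> 1 / C" using that pos C by (simp add: field_simps)
          finally show ?thesis .
        qed
        have "real_of_int \<bar>y $ i\<bar> * \<bar>(\<Theta> *v real_vec q) $ i - \<eta> $ i - of_int (r $ i)\<bar> \<le> 1 / C" for i
        proof (rule ratio[OF assms(1)[of i]])
          show "C * \<alpha> i Y \<le> \<alpha> i (Y / \<epsilon>)"
            using a(2)[of \<epsilon> i Y] \<epsilon> \<epsilon>\<^sub>0_le(1)[of i] T\<^sub>0(2)[of i] Y by linarith
          show "real_of_int \<bar>y $ i\<bar> \<le> \<alpha> i Y"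
            using weighted_size_le_iff[of \<alpha> Y "real_vec y", OF assms(1)] Y
            by (simp add: Y_def real_vec_def)
          show "\<bar>(\<Theta> *v real_vec q) $ i - \<eta> $ i - of_int (r $ i)\<bar> \<le> \<alpha> i (\<epsilon> / Y)"
            using q(1)[of i] by (simp add: dist_nearest_int_def r_def)
        qed (use Y in auto)
        moreover have "real_of_int \<bar>q $ j\<bar> * \<bar>(transpose \<Theta> *v real_vec y) $ j - of_int (p $ j)\<bar> \<le> 1 / C" for j
        proof (rule ratio[OF assms(3)[of j]])
          show "C * \<beta> j T \<le> \<beta> j (T / \<epsilon>)"
            using b(2)[of \<epsilon> j T] \<epsilon> \<epsilon>\<^sub>0_le(2)[of j] T\<^sub>0(3)[of j] T by linarith
          have "\<epsilon> / T = f Y" using \<epsilon> unfolding T_def by simp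
          then show "\<bar>(transpose \<Theta> *v real_vec y) $ j - of_int (p $ j)\<bar> \<le> \<beta> j (\<epsilon> / T)"
            using weighted_size_le_iff[of \<beta> "f Y", OF assms(3)] p fY by (simp add: real_vec_def)
        qed (use T q in auto)
        ultimately obtain k :: int where
          "\<bar>real_vec y \<bullet> \<eta> - of_int k\<bar> \<le> real (CARD('n) + CARD('m)) * (1 / C)"
          using inner_near_int_transference by blast
        also have "real (CARD('n) + CARD('m)) * (1 / C) = 1 / 6" using C by (simp add: C_def field_simps)
        finally show ?thesis by (rule cos_ge_half_near_int)
      qed
      then have "\<eta> \<in> F R" unfolding F_def by blast
      then show "\<eta> \<in> (\<Union>R. F R)" by blast
    qed
    \<comment> \<open>Completeness of Lebesgue measure gives both measurability and nullity of the
      subset \<open>?D\<close>.\<close>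
    ultimately show ?thesis by (rule null_sets_completion_subset[rotated])
  qed
  then show ?thesis using \<open>\<epsilon>\<^sub>0 > 0\<close> by blast
qed

end
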